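(* Let $P$ be an ordinary point that does not lie on the extended sides of triangle $ABC$ or of its anticomplementary triangle, does not lie on a median of $ABC$, and whose isotomic conjugate $P'$ is ordinary (i.e. $P\notin\iota(l_\infty)$). Then the affine maps $T_P$ and $T_{P'}$ satisfy $\eta\, T_P = T_{P'}\,\eta$, and so are conjugate to each other in the affine group.
   Context: Work in the extended Euclidean plane: the Euclidean plane together with the line at infinity $l_\infty$. Points on $l_\infty$ are called infinite, all other points ordinary; affine maps are extended to $l_\infty$. $XY$ denotes the line through $X$ and $Y$, and $l\cdot m$ the intersection point of lines $l$ and $m$. $ABC$ is a (nondegenerate) triangle with centroid $G$; medians are the full lines $AG,BG,CG$. $K$ is the homothety with center $G$ and ratio $-1/2$; the anticomplementary triangle is $K^{-1}(ABC)$. $D=AP\cdot BC$, $E=BP\cdot CA$, $F=CP\cdot AB$ are the traces of $P$, and $D_3,E_3,F_3$ are their reflections in the midpoints of $BC,CA,AB$ respectively; the lines $AD_3,BE_3,CF_3$ meet in the isotomic conjugate $P'=\iota(P)$ of $P$. Put $Q=K(P')$, $Q'=K(P)$. $T_P$ is the unique affine map with $A\mapsto D$, $B\mapsto E$, $C\mapsto F$; $T_{P'}$ is the unique affine map with $A\mapsto D_3$, $B\mapsto E_3$, $C\mapsto F_3$. $V=PQ\cdot P'Q'$, and $V_\infty=PP'\cdot QQ'$ is an infinite point (the lines $PP'$ and $QQ'$ are parallel). $\eta$ is the harmonic homology with center $V_\infty$ and axis $GV$: the affine reflection that fixes the line $GV$ pointwise and maps each ordinary point $Y\notin GV$ to the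 point $Y'$ such that $YY'\parallel PP'$ and the midpoint of $YY'$ lies on $GV$. Products of maps denote composition, right factor applied first. *)

theory Defs
  imports "HOL-Analysis.Analysis" "HOL-Algebra.Group"
begin

section \<open>The extended Euclidean plane\<close>

type_synonym plane = "real^2"

text \<open>A point at infinity is a direction, i.e. a one-dimensional linear subspace.\<close>

typedef direction = "{S :: plane set. subspace S \<and> dim S = 1}"
proof
  show "span {axis 1 1} \<in> {S :: plane set. subspace S \<and> dim S = 1}"
    by (simp add: dim_span dim_singleton axis_eq_0_iff)
qed

datatype epoint = Ordinary plane | Infinite direction

definition line_at_infinity :: "epoint set" where
  "line_at_infinity = range Infinite"

definition extend_line :: "plane set \<Rightarrow> epoint set" where
  "extend_line l = Ordinary ` l \<union> {Infinite d | d. affine_parallel (Rep_direction d) l}"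

definition elines :: "epoint set set" where
  "elines = insert line_at_infinity {extend_line l | l. affine l \<and> aff_dim l = 1}"

text \<open>\<open>join X Y\<close> is the line \<open>XY\<close> (meaningful for \<open>X \<noteq> Y\<close>) and \<open>meet l m\<close> is the point
  \<open>l \<cdot> m\<close> (meaningful for distinct lines).\<close>

definition join :: "epoint \<Rightarrow> epoint \<Rightarrow> epoint set" where
  "join X Y = (THE l. l \<in> elines \<and> X \<in> l \<and> Y \<in> l)"

definition meet :: "epoint set \<Rightarrow> epoint set \<Rightarrow> epoint" where
  "meet l m = (THE X. X \<in> l \<and> X \<in> m)"

section \<open>Affine maps\<close>

definition affine_map :: "(plane \<Rightarrow> plane) \<Rightarrow> bool" where
  "affine_map f \<longleftrightarrow> (\<exists>L b. linear L \<and> f = (\<lambda>x. L x + b))"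

text \<open>Extension of a bijective affine map to the line at infinity; \<open>\<lambda>v. f v - f 0\<close> is the
  linear part of \<open>f\<close>.\<close>

fun extend_map :: "(plane \<Rightarrow> plane) \<Rightarrow> epoint \<Rightarrow> epoint" where
  "extend_map f (Ordinary X) = Ordinary (f X)"
| "extend_map f (Infinite d) = Infinite (Abs_direction ((\<lambda>v. f v - f 0) ` Rep_direction d))"

definition affine_group :: "(plane \<Rightarrow> plane) monoid" where
  "affine_group = \<lparr>carrier = {f. affine_map f \<and> bij f}, mult = (\<circ>), one = id\<rparr>"

definition conjugate_in :: "('a, 'b) monoid_scheme \<Rightarrow> 'a \<Rightarrow> 'a \<Rightarrow> bool" where
  "conjugate_in H x y \<longleftrightarrow> x \<in> carrier H \<and> y \<in> carrier H \<and>
     (\<exists>g \<in> carrier H. y = g \<otimes>\<^bsub>H\<^esub> x \<otimes>\<^bsub>H\<^esub> inv\<^bsub>H\<^esub> g)"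

definition homothety :: "plane \<Rightarrow> real \<Rightarrow> plane \<Rightarrow> plane" where
  "homothety Z r X = Z + r *\<^sub>R (X - Z)"

definition point_reflection :: "plane \<Rightarrow> plane \<Rightarrow> plane" where
  "point_reflection M X = 2 *\<^sub>R M - X"

text \<open>The harmonic homology with infinite center \<open>Z\<close> and axis \<open>l\<close>, on ordinary points.\<close>

definition affine_reflection :: "epoint \<Rightarrow> epoint set \<Rightarrow> plane \<Rightarrow> plane" where
  "affine_reflection Z l Y =
     (if Ordinary Y \<in> l then Y
      else (THE Y'. Ordinary Y' \<in> join (Ordinary Y) Z \<and> Ordinary (midpoint Y Y') \<in> l))"

text \<open>The affine map taking \<open>A, B, C\<close> to the points \<open>X, Y, Z\<close> (which have to be ordinary).\<close>

definition affine_map_taking ::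
    "plane \<Rightarrow> plane \<Rightarrow> plane \<Rightarrow> epoint \<Rightarrow> epoint \<Rightarrow> epoint \<Rightarrow> plane \<Rightarrow> plane" where
  "affine_map_taking A B C X Y Z =
     (THE T. affine_map T \<and> Ordinary (T A) = X \<and> Ordinary (T B) = Y \<and> Ordinary (T C) = Z)"

section \<open>Triangle geometry\<close>

abbreviation line :: "plane \<Rightarrow> plane \<Rightarrow> epoint set" where
  "line X Y \<equiv> join (Ordinary X) (Ordinary Y)"

definition centroid :: "plane \<Rightarrow> plane \<Rightarrow> plane \<Rightarrow> plane" where
  "centroid A B C = (1/3) *\<^sub>R (A + B + C)"

definition K_map :: "plane \<Rightarrow> plane \<Rightarrow> plane \<Rightarrow> plane \<Rightarrow> plane" where
  "K_map A B C = homothety (centroid A B C) (- (1/2))"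

definition on_sides :: "plane \<Rightarrow> plane \<Rightarrow> plane \<Rightarrow> epoint \<Rightarrow> bool" where
  "on_sides A B C P \<longleftrightarrow> P \<in> line B C \<or> P \<in> line C A \<or> P \<in> line A B"

definition on_anticomplementary_sides :: "plane \<Rightarrow> plane \<Rightarrow> plane \<Rightarrow> epoint \<Rightarrow> bool" where
  "on_anticomplementary_sides A B C P \<longleftrightarrow>
     (let K_inv = inv_into UNIV (K_map A B C) in on_sides (K_inv A) (K_inv B) (K_inv C) P)"

definition on_medians :: "plane \<Rightarrow> plane \<Rightarrow> plane \<Rightarrow> epoint \<Rightarrow> bool" where
  "on_medians A B C P \<longleftrightarrow>
     (let G = centroid A B C in P \<in> line A G \<or> P \<in> line B G \<or> P \<in> line C G)"

text \<open>\<open>side_trace A B C P\<close> is the trace of \<open>P\<close> on the side \<open>BC\<close> and \<open>trace_refl A B C P\<close> its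
  reflection in the midpoint of \<open>BC\<close>; the other traces \<open>E, F\<close> (and \<open>E\<^sub>3, F\<^sub>3\<close>) are obtained by
  permuting the vertices cyclically.\<close>

definition side_trace :: "plane \<Rightarrow> plane \<Rightarrow> plane \<Rightarrow> epoint \<Rightarrow> epoint" where
  "side_trace A B C P = meet (join (Ordinary A) P) (line B C)"

definition trace_refl :: "plane \<Rightarrow> plane \<Rightarrow> plane \<Rightarrow> epoint \<Rightarrow> epoint" where
  "trace_refl A B C P = extend_map (point_reflection (midpoint B C)) (side_trace A B C P)"

definition isotomic_conjugate :: "plane \<Rightarrow> plane \<Rightarrow> plane \<Rightarrow> epoint \<Rightarrow> epoint" where
  "isotomic_conjugate A B C P =
     (THE X. X \<in> join (Ordinary A) (trace_refl A B C P) \<and>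
             X \<in> join (Ordinary B) (trace_refl B C A P) \<and>
             X \<in> join (Ordinary C) (trace_refl C A B P))"

text \<open>\<open>T_map\<close> is \<open>T\<^sub>P\<close>; \<open>T_map'\<close> is \<open>T\<^sub>P\<^sub>'\<close>, defined through the reflected traces of \<open>P\<close>.\<close>

definition T_map :: "plane \<Rightarrow> plane \<Rightarrow> plane \<Rightarrow> epoint \<Rightarrow> plane \<Rightarrow> plane" where
  "T_map A B C P =
     affine_map_taking A B C (side_trace A B C P) (side_trace B C A P) (side_trace C A B P)"

definition T_map' :: "plane \<Rightarrow> plane \<Rightarrow> plane \<Rightarrow> epoint \<Rightarrow> plane \<Rightarrow> plane" where
  "T_map' A B C P =
     affine_map_taking A B C (trace_refl A B C P) (trace_refl B C A P) (trace_refl C A B P)"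

definition eta :: "plane \<Rightarrow> plane \<Rightarrow> plane \<Rightarrow> epoint \<Rightarrow> plane \<Rightarrow> plane" where
  "eta A B C P =
     (let G = Ordinary (centroid A B C);
          K = extend_map (K_map A B C);
          P' = isotomic_conjugate A B C P;
          Q = K P';
          Q' = K P;
          V = meet (join P Q) (join P' Q');
          V_inf = meet (join P P') (join Q Q')
      in affine_reflection V_inf (join G V))"

end

theory Submission
  imports Defs
begin

text \<open>
  Write \<open>p = P - G\<close> and \<open>p' = P' - G\<close>. Since \<open>P\<close> lies on no median, \<open>p\<close> and \<open>p'\<close> are linearly
  independent, hence a basis of the plane. In this basis \<open>K\<close> gives \<open>Q = G - p'/2\<close> and
  \<open>Q' = G - p/2\<close>, so \<open>PP'\<close> and \<open>QQ'\<close> both have direction \<open>p' - p\<close>, and the lines \<open>PQ\<close> and \<open>P'Q'\<close>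
  meet in \<open>V = G - (p + p')\<close>. Therefore \<open>\<eta>\<close> is the affine map that fixes \<open>G\<close> and exchanges \<open>p\<close> and \<open>p'\<close>;
  in particular it is an involution that exchanges \<open>P\<close> with \<open>P'\<close> and \<open>Q\<close> with \<open>Q'\<close>.

  Barycentric coordinates give three facts about \<open>T\<^sub>P\<close>: it fixes \<open>Q\<close>, it maps \<open>Q'\<close> to \<open>P\<close>, and it moves
  \<open>G\<close> parallel to \<open>PP'\<close>. The other map needs no separate computation: the midpoint of \<open>D\<close> and \<open>D\<^sub>3\<close> is
  the midpoint \<open>K(A)\<close> of \<open>BC\<close>, and so on cyclically, so \<open>T\<^sub>P(X) + T\<^sub>P\<^sub>'(X) = 2 K(X)\<close> at the vertices and hence
  everywhere. This identity turns the three facts into \<open>T\<^sub>P\<^sub>'(Q) = P'\<close>, \<open>T\<^sub>P\<^sub>'(Q') = Q'\<close> and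
  \<open>T\<^sub>P\<^sub>'(G) = 2 G - T\<^sub>P(G) = \<eta>(T\<^sub>P(G))\<close>. Consequently \<open>\<eta> T\<^sub>P\<close> and \<open>T\<^sub>P\<^sub>' \<eta>\<close> agree at the three points \<open>G\<close>, \<open>Q\<close>
  and \<open>Q'\<close>, which are not collinear because \<open>p\<close> and \<open>p'\<close> are independent; an affine map is determined by
  its values at three such points. The intertwining relation is \<open>\<eta>_intertwines\<close>. As \<open>\<eta>\<close> is its own inverse and
  \<open>T\<^sub>P\<close> is bijective, conjugacy follows.
\<close>

section \<open>The area form of the plane\<close>

text \<open>
  The determinant of two plane vectors. Parallelism, incidence and collinearity all become the
  vanishing of this bilinear form, which leaves only algebraic identities to verify.
\<close>
definition wedge :: "plane \<Rightarrow> plane \<Rightarrow> real" where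
  "wedge u v = u $ 1 * v $ 2 - u $ 2 * v $ 1"

lemma plane_eq_iff: "u = v \<longleftrightarrow> u $ 1 = v $ 1 \<and> u $ 2 = v $ 2" for u v :: plane
  by (simp add: vec_eq_iff forall_2)

lemma wedge_simps [simp]:
  "wedge 0 v = 0" "wedge u 0 = 0" "wedge u u = 0"
  "wedge (r *\<^sub>R u) v = r * wedge u v" "wedge u (r *\<^sub>R v) = r * wedge u v"
  "wedge (- u) v = - wedge u v" "wedge u (- v) = - wedge u v"
  by (simp_all add: wedge_def algebra_simps)

lemma wedge_distribs:
  "wedge (u + u') v = wedge u v + wedge u' v" "wedge u (v + v') = wedge u v + wedge u v'"
  "wedge (u - u') v = wedge u v - wedge u' v" "wedge u (v - v') = wedge u v - wedge u v'"
  by (simp_all add: wedge_def algebra_simps)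

lemma wedge_commute: "wedge v u = - wedge u v"
  by (simp add: wedge_def)

lemma wedge_combinations:
  "wedge (a *\<^sub>R u + b *\<^sub>R v) (c *\<^sub>R u + d *\<^sub>R v) = (a * d - b * c) * wedge u v"
  by (simp add: wedge_def algebra_simps)

lemma wedge_cramer:
  "wedge u v *\<^sub>R x = wedge x v *\<^sub>R u + wedge u x *\<^sub>R v"
  by (simp add: plane_eq_iff wedge_def algebra_simps)

lemma wedge_eq_0_imp_multiple:
  assumes "u \<noteq> 0" "wedge u v = 0"
  obtains t where "v = t *\<^sub>R u"
proof -
  have "wedge u v = 0" by fact
  hence e: "u $ 1 * v $ 2 = u $ 2 * v $ 1" by (simp add: wedge_def)
  show thesis
  proof (cases "u $ 1 = 0")
    case True
    hence "u $ 2 \<noteq> 0" using assms(1) by (simp add: plane_eq_iff)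
    with True e have "v = (v $ 2 / u $ 2) *\<^sub>R u" by (simp add: plane_eq_iff)
    thus thesis by (rule that)
  next
    case False
    with e have "v = (v $ 1 / u $ 1) *\<^sub>R u" by (simp add: plane_eq_iff field_simps)
    thus thesis by (rule that)
  qed
qed

lemma collinear_iff_wedge:
  "collinear {A, B, C :: plane} \<longleftrightarrow> wedge (B - A) (C - A) = 0"
proof -
  have "{A, B, C} = {B, A, C}" by blast
  hence "collinear {A, B, C} \<longleftrightarrow> collinear {B, A, C}" by simp
  also have "\<dots> \<longleftrightarrow> collinear {0, B - A, C - A}" by (rule collinear_3) (simp add: NO_MATCH_def)
  also have "\<dots> \<longleftrightarrow> wedge (B - A) (C - A) = 0"
    unfolding collinear_lemma using wedge_eq_0_imp_multiple[of "B - A" "C - A"] by fastforce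
  finally show ?thesis .
qed

section \<open>Lines of the extended plane\<close>

text \<open>
  The ordinary line through \<open>a\<close> with direction \<open>u\<close>, given by an equation instead of a parametrisation so
  that incidence with an ordinary point can be decided by rewriting.
\<close>
definition ordinary_line :: "plane \<Rightarrow> plane \<Rightarrow> epoint set" where
  "ordinary_line a u = extend_line {x. wedge u (x - a) = 0}"

definition point_at_infinity :: "plane \<Rightarrow> epoint" where
  "point_at_infinity u = Infinite (Abs_direction (span {u}))"

lemma span_wedge: "u \<noteq> 0 \<Longrightarrow> span {u} = {v. wedge u v = 0}"
  by (auto simp: span_singleton elim: wedge_eq_0_imp_multiple)

lemma Rep_direction_Abs_span:
  "u \<noteq> 0 \<Longrightarrow> Rep_direction (Abs_direction (span {u})) = {v. wedge u v = 0}"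
  by (subst Abs_direction_inverse) (simp_all add: subspace_span, simp add: span_wedge)

lemma dim_1_subspace:
  fixes S :: "plane set"
  assumes "subspace S" "dim S = 1"
  obtains u where "u \<noteq> 0" "S = span {u}"
proof -
  obtain b where b: "b \<subseteq> S" "independent b" "S \<subseteq> span b" "card b = dim S"
    using basis_exists by metis
  then obtain u where u: "b = {u}" using assms(2) card_1_singletonE by metis
  have "u \<noteq> 0" using b(2) u dependent_zero by blast
  moreover have "S = span {u}" using b u assms(1) by (metis span_minimal subset_antisym)
  ultimately show thesis by (rule that)
qed

lemma direction_cases:
  obtains u where "u \<noteq> 0" "Infinite d = point_at_infinity u"
proof -
  obtain u where "u \<noteq> 0" "Rep_direction d = span {u}"
    using Rep_direction[of d] dim_1_subspace by blast
  thus thesis using that[of u] by (metis Rep_direction_inverse point_at_infinity_def)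
qed

text \<open>
  Equal directions have equal equations \<open>wedge u x = 0\<close>; testing \<open>x = v\<close> gives one implication, and
  the other holds because \<open>v\<close> is then a nonzero multiple of \<open>u\<close>.
\<close>
lemma point_at_infinity_eq_iff:
  assumes "u \<noteq> 0" "v \<noteq> 0"
  shows "point_at_infinity u = point_at_infinity v \<longleftrightarrow> wedge u v = 0"
proof
  assume "point_at_infinity u = point_at_infinity v"
  hence "Rep_direction (Abs_direction (span {u})) = Rep_direction (Abs_direction (span {v}))"
    by (simp add: point_at_infinity_def)
  hence "{x. wedge u x = 0} = {x. wedge v x = 0}"
    by (simp only: Rep_direction_Abs_span assms simp_thms)
  hence "v \<in> {x. wedge u x = 0} \<longleftrightarrow> v \<in> {x. wedge v x = 0}" by simp
  thus "wedge u v = 0" by simp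
next
  assume "wedge u v = 0"
  then obtain t where t: "v = t *\<^sub>R u" using wedge_eq_0_imp_multiple assms by metis
  with assms(2) have "t \<noteq> 0" by auto
  with t have "{x. wedge v x = 0} = {x. wedge u x = 0}" by simp
  hence "span {v} = span {u}" by (simp only: span_wedge assms simp_thms)
  thus "point_at_infinity u = point_at_infinity v" by (simp add: point_at_infinity_def)
qed

lemma line_set_eq_translate:
  "{x. wedge u (x - a) = 0} = (+) a ` {v. wedge u v = 0}"
proof
  show "{x. wedge u (x - a) = 0} \<subseteq> (+) a ` {v. wedge u v = 0}"
  proof
    fix x assume "x \<in> {x. wedge u (x - a) = 0}"
    thus "x \<in> (+) a ` {v. wedge u v = 0}" by (intro image_eqI[of _ _ "x - a"]) auto
  qed
qed auto

lemma Ordinary_in_ordinary_line [simp]: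
  "Ordinary x \<in> ordinary_line a u \<longleftrightarrow> wedge u (x - a) = 0"
  by (auto simp: ordinary_line_def extend_line_def)

lemma point_at_infinity_in_ordinary_line [simp]:
  assumes "u \<noteq> 0" "v \<noteq> 0"
  shows "point_at_infinity v \<in> ordinary_line a u \<longleftrightarrow> wedge u v = 0"
proof -
  have "point_at_infinity v \<in> ordinary_line a u \<longleftrightarrow>
      affine_parallel {x. wedge v x = 0} {x. wedge u (x - a) = 0}"
    using assms
    by (auto simp: ordinary_line_def extend_line_def point_at_infinity_def Rep_direction_Abs_span)
  also have "\<dots> \<longleftrightarrow> wedge u v = 0"
  proof
    assume "affine_parallel {x. wedge v x = 0} {x. wedge u (x - a) = 0}"
    then obtain c where c: "{x. wedge u (x - a) = 0} = (+) c ` {x. wedge v x = 0}"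
      by (auto simp: affine_parallel_def)
    have "c + 0 \<in> {x. wedge u (x - a) = 0}" "c + v \<in> {x. wedge u (x - a) = 0}"
      unfolding c by (rule imageI, simp)+
    thus "wedge u v = 0" by (simp add: wedge_distribs)
  next
    assume "wedge u v = 0"
    then obtain t where t: "v = t *\<^sub>R u" using wedge_eq_0_imp_multiple assms by metis
    with assms have "{x. wedge v x = 0} = {x. wedge u x = 0}" by auto
    thus "affine_parallel {x. wedge v x = 0} {x. wedge u (x - a) = 0}"
      using line_set_eq_translate[of u a] by (auto simp: affine_parallel_def)
  qed
  finally show ?thesis .
qed

lemma subspace_wedge: "subspace {v. wedge u v = 0}"
  by (rule subspaceI) (auto simp: wedge_distribs)

lemma ordinary_line_in_elines:
  assumes "u \<noteq> 0"
  shows "ordinary_line a u \<in> elines"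
proof -
  have "affine {x. wedge u (x - a) = 0}"
    unfolding line_set_eq_translate using affine_translation subspace_imp_affine subspace_wedge by blast
  moreover have "aff_dim {x. wedge u (x - a) = 0} = 1"
    using assms unfolding line_set_eq_translate
    by (simp add: aff_dim_translation_eq aff_dim_subspace subspace_wedge flip: span_wedge)
  ultimately show ?thesis by (auto simp: elines_def ordinary_line_def)
qed

text \<open>
  Translating a one-dimensional affine set to the origin yields a one-dimensional subspace, and any
  nonzero vector of it serves as direction.
\<close>
lemma elines_cases:
  assumes "l \<in> elines"
  obtains "l = line_at_infinity" | a u where "u \<noteq> 0" "l = ordinary_line a u"
proof (cases "l = line_at_infinity")
  case True
  thus ?thesis by (rule that(1))
next
  case False
  then obtain m where m: "l = extend_line m" "affine m" "aff_dim m = 1"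
    using assms by (auto simp: elines_def)
  have "m \<noteq> {}" using m(3) by auto
  then obtain a where a: "a \<in> m" by blast
  obtain S where S: "subspace S" "S = (+) (- a) ` m"
    using m(2) a by (metis affine_diffs_subspace)
  have "aff_dim S = 1" using m(3) S(2) by (simp only: aff_dim_translation_eq)
  hence "dim S = 1" using S(1) by (simp add: aff_dim_subspace)
  then obtain u where u: "u \<noteq> 0" "S = {v. wedge u v = 0}"
    using dim_1_subspace S(1) span_wedge by metis
  have "m = (+) a ` S" by (simp add: S(2) image_image)
  hence "l = ordinary_line a u" unfolding ordinary_line_def line_set_eq_translate m(1) u(2) by simp
  thus ?thesis using that(2) u(1) by blast
qed

lemma epoint_cases:
  obtains x where "X = Ordinary x" | u where "u \<noteq> 0" "X = point_at_infinity u"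
  by (metis epoint.exhaust direction_cases)

lemma not_at_infinity [simp]:
  "Ordinary x \<notin> line_at_infinity" "point_at_infinity u \<in> line_at_infinity"
  "Ordinary x \<noteq> point_at_infinity u" "point_at_infinity u \<noteq> Ordinary x"
  by (auto simp: line_at_infinity_def point_at_infinity_def)

lemma ordinary_line_eqI:
  assumes "u \<noteq> 0" "v \<noteq> 0" "wedge u v = 0" "wedge u (b - a) = 0"
  shows "ordinary_line a u = ordinary_line b v"
proof -
  obtain t where t: "v = t *\<^sub>R u" using wedge_eq_0_imp_multiple assms by metis
  have "t \<noteq> 0" using t assms by auto
  have "wedge u (x - a) = 0 \<longleftrightarrow> wedge v (x - b) = 0" for x
    using assms(4) t \<open>t \<noteq> 0\<close> by (auto simp: wedge_distribs)
  thus ?thesis by (simp add: ordinary_line_def)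
qed

lemma wedge_eq_0_trans:
  assumes "w \<noteq> 0" "wedge u w = 0" "wedge v w = 0"
  shows "wedge u v = 0"
proof -
  have "wedge w u = 0" using assms(2) by (simp add: wedge_commute[of w u])
  then obtain t where "u = t *\<^sub>R w" using wedge_eq_0_imp_multiple[OF assms(1)] by blast
  thus ?thesis using assms(3) by (simp add: wedge_commute[of w v])
qed

text \<open>
  The definite descriptions in \<^const>\<open>join\<close> and \<^const>\<open>meet\<close> are evaluated by exhibiting one line or point
  with the required incidences; this lemma supplies the uniqueness for both. If one of the two common
  points is ordinary, both lines are ordinary and the other point fixes their direction. Two distinct
  points at infinity never lie on the same ordinary line.
\<close>
lemma eline_unique:
  assumes "l \<in> elines" "m \<in> elines" "X \<noteq> Y" "X \<in> l" "Y \<in> l" "X \<in> m" "Y \<in> m"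
  shows "l = m"
proof -
  have ord: "ordinary_line a u = ordinary_line b v"
    if "u \<noteq> 0" "v \<noteq> 0" "X \<in> ordinary_line a u" "Y \<in> ordinary_line a u"
      "X \<in> ordinary_line b v" "Y \<in> ordinary_line b v" "X \<noteq> Y" "X = Ordinary x" for X Y x a b u v
  proof -
    have x: "wedge u (x - a) = 0" "wedge v (x - b) = 0" using that by auto
    have "wedge u v = 0"
    proof (cases Y rule: epoint_cases)
      case (1 y)
      hence "wedge u (y - a) = 0" "wedge v (y - b) = 0" using that by auto
      hence "wedge u (y - x) = 0" "wedge v (y - x) = 0" using x by (auto simp: wedge_distribs)
      moreover have "y - x \<noteq> 0" using that 1 by auto
      ultimately show ?thesis by (metis wedge_eq_0_trans)
    next
      case (2 w)
      thus ?thesis using that by (auto intro: wedge_eq_0_trans[of w])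
    qed
    moreover from wedge_eq_0_imp_multiple[OF \<open>u \<noteq> 0\<close> this] obtain t where t: "v = t *\<^sub>R u" .
    hence "t \<noteq> 0" using that by auto
    hence "wedge u (b - a) = 0" using x t by (auto simp: wedge_distribs)
    ultimately show ?thesis using ordinary_line_eqI[of u v b a] that by blast
  qed
  have elines: "l = m"
    if "l \<in> elines" "m \<in> elines" "X \<in> l" "Y \<in> l" "X \<in> m" "Y \<in> m" "X \<noteq> Y" "X = Ordinary x"
    for X Y x l m
  proof -
    have "l \<noteq> line_at_infinity" "m \<noteq> line_at_infinity" using that by auto
    from \<open>l \<in> elines\<close> this(1) obtain a u where l: "u \<noteq> 0" "l = ordinary_line a u"
      by (cases rule: elines_cases) auto
    from \<open>m \<in> elines\<close> \<open>m \<noteq> line_at_infinity\<close> obtain b v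
      where m: "v \<noteq> 0" "m = ordinary_line b v"
      by (cases rule: elines_cases) auto
    note lm = l m
    show ?thesis unfolding lm by (rule ord[where X = X and Y = Y and x = x]) (use that lm in simp_all)
  qed
  have inf: "k = line_at_infinity" if "k \<in> elines" "point_at_infinity v \<in> k"
    "point_at_infinity w \<in> k" "v \<noteq> 0" "w \<noteq> 0" "wedge v w \<noteq> 0" for k v w
    using \<open>k \<in> elines\<close>
  proof (cases rule: elines_cases)
    case (2 a u)
    hence "wedge u v = 0" "wedge u w = 0" using that by auto
    hence "wedge v w = 0"
      using 2(1) wedge_eq_0_trans[of u v w] by (simp add: wedge_commute[of u v] wedge_commute[of u w])
    thus ?thesis using that by simp
  qed
  show ?thesis
  proof (cases X rule: epoint_cases)
    case (1 x)
    thus ?thesis using elines assms by blast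
  next
    case X: (2 v)
    show ?thesis
    proof (cases Y rule: epoint_cases)
      case (1 y)
      thus ?thesis using elines[of l m Y X y] assms by simp
    next
      case (2 w)
      hence "wedge v w \<noteq> 0" using X \<open>X \<noteq> Y\<close> by (simp add: point_at_infinity_eq_iff)
      thus ?thesis using inf[of l v w] inf[of m v w] X 2 assms by simp
    qed
  qed
qed

lemma join_eq:
  assumes "l \<in> elines" "X \<in> l" "Y \<in> l" "X \<noteq> Y"
  shows "join X Y = l"
  unfolding join_def
proof (rule the_equality)
  fix m assume "m \<in> elines \<and> X \<in> m \<and> Y \<in> m"
  thus "m = l" using eline_unique[of m l X Y] assms by simp
qed (use assms in simp)

lemma meet_eq:
  assumes "l \<in> elines" "m \<in> elines" "l \<noteq> m" "X \<in> l" "X \<in> m"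
  shows "meet l m = X"
  unfolding meet_def
proof (rule the_equality)
  fix Y assume "Y \<in> l \<and> Y \<in> m"
  thus "Y = X" using eline_unique[of l m Y X] assms by blast
qed (use assms in simp)

lemma line_eq: "X \<noteq> Y \<Longrightarrow> line X Y = ordinary_line X (Y - X)"
  by (rule join_eq) (auto intro: ordinary_line_in_elines)

lemma join_point_at_infinity:
  "u \<noteq> 0 \<Longrightarrow> join (Ordinary X) (point_at_infinity u) = ordinary_line X u"
  by (rule join_eq) (auto intro: ordinary_line_in_elines)

lemma meet_ordinary_lines:
  assumes "wedge u v \<noteq> 0" "wedge u (x - a) = 0" "wedge v (x - b) = 0"
  shows "meet (ordinary_line a u) (ordinary_line b v) = Ordinary x"
proof -
  have nz: "u \<noteq> 0" "v \<noteq> 0" using assms by auto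
  hence "point_at_infinity u \<in> ordinary_line a u" "point_at_infinity u \<notin> ordinary_line b v"
    using assms by (auto simp: wedge_commute[of v u])
  hence "ordinary_line a u \<noteq> ordinary_line b v" by metis
  thus ?thesis using assms nz by (intro meet_eq ordinary_line_in_elines) auto
qed

lemma meet_parallel_lines:
  assumes "u \<noteq> 0" "v \<noteq> 0" "wedge u v = 0" "wedge u (b - a) \<noteq> 0"
  shows "meet (ordinary_line a u) (ordinary_line b v) = point_at_infinity u"
proof -
  have "Ordinary b \<notin> ordinary_line a u" "Ordinary b \<in> ordinary_line b v" using assms by auto
  hence "ordinary_line a u \<noteq> ordinary_line b v" by metis
  thus ?thesis using assms
    by (intro meet_eq ordinary_line_in_elines) (auto simp: wedge_commute[of v u])
qed


section \<open>Affine maps of the plane\<close>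

text \<open>
  Cramer's rule for \<open>X - A\<close> in the basis \<open>B - A\<close>, \<open>C - A\<close>.
\<close>
lemma barycentric_coordinates:
  assumes "wedge (B - A) (C - A) \<noteq> 0"
  obtains x y z where "x + y + z = 1" "X = x *\<^sub>R A + y *\<^sub>R B + z *\<^sub>R C"
proof -
  define w where "w = wedge (B - A) (C - A)"
  define y where "y = wedge (X - A) (C - A) / w"
  define z where "z = wedge (B - A) (X - A) / w"
  have "X - A = (1 / w) *\<^sub>R (w *\<^sub>R (X - A))" using assms by (simp add: w_def)
  also have "w *\<^sub>R (X - A) = wedge (X - A) (C - A) *\<^sub>R (B - A) + wedge (B - A) (X - A) *\<^sub>R (C - A)"
    unfolding w_def by (rule wedge_cramer)
  also have "(1 / w) *\<^sub>R \<dots> = y *\<^sub>R (B - A) + z *\<^sub>R (C - A)"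
    by (simp add: y_def z_def scaleR_add_right)
  finally have "X = (1 - y - z) *\<^sub>R A + y *\<^sub>R B + z *\<^sub>R C"
    by (simp add: algebra_simps)
  thus thesis by (intro that[of "1 - y - z" y z]) simp_all
qed

lemma affine_map_combination:
  assumes "affine_map f" "x + y + z = 1"
  shows "f (x *\<^sub>R A + y *\<^sub>R B + z *\<^sub>R C) = x *\<^sub>R f A + y *\<^sub>R f B + z *\<^sub>R f C"
proof -
  obtain L b where f: "linear L" "f = (\<lambda>x. L x + b)" using assms(1) by (auto simp: affine_map_def)
  have "x *\<^sub>R b + (y *\<^sub>R b + z *\<^sub>R b) = b" using assms(2) by (simp add: add_ac flip: scaleR_add_left)
  thus ?thesis by (simp add: f linear_add linear_scale scaleR_add_right add_ac)
qed

lemma affine_map_eqI: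
  assumes "affine_map f" "affine_map g" "wedge (B - A) (C - A) \<noteq> 0"
    and "f A = g A" "f B = g B" "f C = g C"
  shows "f = g"
proof
  fix X
  obtain x y z where "x + y + z = 1" "X = x *\<^sub>R A + y *\<^sub>R B + z *\<^sub>R C"
    using barycentric_coordinates assms(3) by metis
  thus "f X = g X" using assms by (simp add: affine_map_combination)
qed

lemma linear_wedge: "linear (\<lambda>X. wedge X v *\<^sub>R d)" "linear (\<lambda>X. wedge v X *\<^sub>R d)"
  by (auto intro!: linearI simp: wedge_distribs scaleR_add_left)

lemma affine_map_compose:
  assumes "affine_map f" "affine_map g"
  shows "affine_map (f \<circ> g)"
proof -
  obtain L b M c where "linear L" "f = (\<lambda>x. L x + b)" "linear M" "g = (\<lambda>x. M x + c)"
    using assms by (auto simp: affine_map_def)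
  hence "linear (L \<circ> M)" "f \<circ> g = (\<lambda>x. (L \<circ> M) x + (L c + b))"
    by (auto simp: linear_compose linear_add)
  thus ?thesis unfolding affine_map_def by blast
qed

lemma affine_map_id: "affine_map id"
  unfolding affine_map_def by (intro exI[of _ id] exI[of _ 0]) (auto simp: linear_id)

text \<open>
  The map is written down explicitly with the barycentric coordinates of its argument, and it is the only
  one because affine maps preserve affine combinations.
\<close>
lemma affine_map_taking:
  fixes A B C A' B' C' :: plane
  assumes "wedge (B - A) (C - A) \<noteq> 0"
  defines "T \<equiv> affine_map_taking A B C (Ordinary A') (Ordinary B') (Ordinary C')"
  shows "affine_map T" "T A = A'" "T B = B'" "T C = C'"
proof -
  define w where "w = wedge (B - A) (C - A)"
  define L where "L X = wedge X (C - A) *\<^sub>R ((1 / w) *\<^sub>R (B' - A'))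
    + wedge (B - A) X *\<^sub>R ((1 / w) *\<^sub>R (C' - A'))" for X
  define f where "f X = L X + (A' - L A)" for X
  have L: "linear L" unfolding L_def by (intro linear_compose_add linear_wedge)
  hence f: "affine_map f" unfolding affine_map_def f_def by blast
  have "f A = A'" by (simp add: f_def)
  moreover have "f B = A' + L (B - A)" "f C = A' + L (C - A)"
    by (simp_all add: f_def linear_diff[OF L])
  hence "f B = B'" "f C = C'" using assms(1) by (simp_all add: L_def w_def)
  ultimately have f_vertices: "f A = A'" "f B = B'" "f C = C'" by blast+
  have "T = f"
    unfolding T_def affine_map_taking_def
  proof (rule the_equality)
    fix g
    assume "affine_map g \<and> Ordinary (g A) = Ordinary A' \<and> Ordinary (g B) = Ordinary B' \<and>
      Ordinary (g C) = Ordinary C'"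
    thus "g = f" by (intro affine_map_eqI[OF _ f assms(1)]) (simp_all add: f_vertices)
  qed (simp add: f f_vertices)
  with f f_vertices show "affine_map T" "T A = A'" "T B = B'" "T C = C'" by simp_all
qed

text \<open>
  The affine map that sends the image triangle back to the original one is a two-sided inverse, because
  both composites fix a nondegenerate triangle.
\<close>
lemma affine_map_bij:
  assumes "affine_map f" "wedge (B - A) (C - A) \<noteq> 0" "wedge (f B - f A) (f C - f A) \<noteq> 0"
  shows "bij f"
proof -
  define g where "g = affine_map_taking (f A) (f B) (f C) (Ordinary A) (Ordinary B) (Ordinary C)"
  note g = affine_map_taking[OF assms(3), of A B C, folded g_def]
  have "g \<circ> f = id"
    by (rule affine_map_eqI[OF affine_map_compose[OF g(1) assms(1)] affine_map_id assms(2)])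
       (simp_all add: g)
  moreover have "f \<circ> g = id"
    by (rule affine_map_eqI[OF affine_map_compose[OF assms(1) g(1)] affine_map_id assms(3)])
       (simp_all add: g)
  ultimately show ?thesis by (rule o_bij)
qed

text \<open>
  An involution is its own inverse in the affine group, so the relation \<open>e f = g e\<close> reads
  \<open>g = e f e\<^sup>-\<^sup>1\<close>. Bijectivity of \<open>g\<close> follows from the same formula.
\<close>
lemma conjugate_by_involution:
  assumes "affine_map f" "bij f" "affine_map e" "e \<circ> e = id" "e \<circ> f = g \<circ> e"
  shows "conjugate_in affine_group f g"
proof -
  have "bij e" using assms(4) assms(4) by (rule o_bij)
  have "g = g \<circ> (e \<circ> e)" using assms(4) by simp
  also have "\<dots> = e \<circ> f \<circ> e" by (simp add: assms(5) flip: comp_assoc)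
  finally have g: "g = e \<circ> f \<circ> e" .
  have e: "e \<in> carrier affine_group" using assms(3) \<open>bij e\<close> by (simp add: affine_group_def)
  have "inv\<^bsub>affine_group\<^esub> e = e"
    unfolding m_inv_def
  proof (rule the_equality)
    fix h
    assume "h \<in> carrier affine_group \<and> e \<otimes>\<^bsub>affine_group\<^esub> h = \<one>\<^bsub>affine_group\<^esub> \<and>
      h \<otimes>\<^bsub>affine_group\<^esub> e = \<one>\<^bsub>affine_group\<^esub>"
    hence "e \<circ> h = id" by (simp add: affine_group_def)
    hence "e = (e \<circ> e) \<circ> h" by (simp add: comp_assoc)
    thus "h = e" by (simp add: assms(4))
  qed (use e assms(4) in \<open>simp add: affine_group_def\<close>)
  moreover have "e \<in> carrier affine_group" "f \<in> carrier affine_group" "g \<in> carrier affine_group"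
    using assms(1-3) \<open>bij e\<close> unfolding g by (simp_all add: affine_group_def affine_map_compose bij_comp)
  moreover have "g = e \<otimes>\<^bsub>affine_group\<^esub> f \<otimes>\<^bsub>affine_group\<^esub> e" by (simp add: affine_group_def g)
  ultimately show ?thesis unfolding conjugate_in_def by metis
qed

section \<open>Reflections\<close>

text \<open>
  The image of \<open>Y\<close> has the form \<open>Y + t u\<close>, and its midpoint with \<open>Y\<close> is \<open>Y + (t/2) u\<close>; the equation
  of the axis is linear in \<open>t\<close> and has a unique solution since \<open>u\<close> is not parallel to the axis.
\<close>
lemma affine_reflection_eq:
  assumes "wedge w u \<noteq> 0"
  shows "affine_reflection (point_at_infinity u) (ordinary_line G w) Y
    = Y - (2 * wedge w (Y - G) / wedge w u) *\<^sub>R u"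
proof (cases "wedge w (Y - G) = 0")
  case True
  thus ?thesis by (simp add: affine_reflection_def)
next
  case False
  have u: "u \<noteq> 0" using assms by auto
  have mid: "midpoint Y (Y + t *\<^sub>R u) - G = (Y - G) + (t / 2) *\<^sub>R u" for t
    by (simp add: midpoint_def plane_eq_iff field_simps)
  have "(THE Y'. Ordinary Y' \<in> join (Ordinary Y) (point_at_infinity u) \<and>
      Ordinary (midpoint Y Y') \<in> ordinary_line G w) = Y + (- 2 * wedge w (Y - G) / wedge w u) *\<^sub>R u"
  proof (rule the_equality)
    fix Y'
    assume *: "Ordinary Y' \<in> join (Ordinary Y) (point_at_infinity u) \<and>
      Ordinary (midpoint Y Y') \<in> ordinary_line G w"
    hence "wedge u (Y' - Y) = 0" by (simp add: join_point_at_infinity u)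
    then obtain t where "Y' - Y = t *\<^sub>R u" using wedge_eq_0_imp_multiple u by metis
    hence t: "Y' = Y + t *\<^sub>R u" by (simp add: algebra_simps)
    have "wedge w (Y - G) + t / 2 * wedge w u = 0"
      using * unfolding t by (simp add: mid wedge_distribs(2))
    hence "t = - 2 * wedge w (Y - G) / wedge w u" using assms by (simp add: field_simps)
    thus "Y' = Y + (- 2 * wedge w (Y - G) / wedge w u) *\<^sub>R u" using t by simp
  next
    show "Ordinary (Y + (- 2 * wedge w (Y - G) / wedge w u) *\<^sub>R u) \<in> join (Ordinary Y) (point_at_infinity u) \<and>
      Ordinary (midpoint Y (Y + (- 2 * wedge w (Y - G) / wedge w u) *\<^sub>R u)) \<in> ordinary_line G w"
      unfolding join_point_at_infinity[OF u] Ordinary_in_ordinary_line mid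
      using assms by (simp add: wedge_distribs(2,4) field_simps)
  qed
  thus ?thesis using False by (simp add: affine_reflection_def)
qed

section \<open>Traces and the isotomic conjugate\<close>

lemma weighted_mean_diff:
  fixes X Y Z :: plane
  assumes "t = a + b" "t \<noteq> 0"
  shows "(1 / t) *\<^sub>R (a *\<^sub>R X + b *\<^sub>R Y) - Z = (1 / t) *\<^sub>R (a *\<^sub>R (X - Z) + b *\<^sub>R (Y - Z))"
proof -
  have eq: "a *\<^sub>R (X - Z) + b *\<^sub>R (Y - Z) = (a *\<^sub>R X + b *\<^sub>R Y) - t *\<^sub>R Z"
    by (simp add: assms(1) algebra_simps)
  show ?thesis unfolding eq using assms(2) by (simp add: scaleR_diff_right)
qed

lemma weighted_mean_add_reversed:
  fixes X Y :: plane
  assumes "t = a + b" "t \<noteq> 0"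
  shows "(1 / t) *\<^sub>R (a *\<^sub>R X + b *\<^sub>R Y) + (1 / t) *\<^sub>R (b *\<^sub>R X + a *\<^sub>R Y) = X + Y"
proof -
  have "(a *\<^sub>R X + b *\<^sub>R Y) + (b *\<^sub>R X + a *\<^sub>R Y) = t *\<^sub>R (X + Y)"
    by (simp add: assms(1) algebra_simps)
  thus ?thesis using assms(2) by (simp flip: scaleR_add_right)
qed

text \<open>
  Omitting the first barycentric coordinate and normalising projects \<open>P\<close> from \<open>A\<close> onto \<open>BC\<close>. The condition
  \<open>y + z \<noteq> 0\<close> says that \<open>AP\<close> is not parallel to \<open>BC\<close>; it also guarantees \<open>P \<noteq> A\<close>.
\<close>
lemma side_trace_eq:
  assumes "wedge (B - A) (C - A) \<noteq> 0" "x + y + z = 1" "y + z \<noteq> 0"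
  shows "side_trace A B C (Ordinary (x *\<^sub>R A + y *\<^sub>R B + z *\<^sub>R C))
    = Ordinary ((1 / (y + z)) *\<^sub>R (y *\<^sub>R B + z *\<^sub>R C))"
proof -
  define P where "P = x *\<^sub>R A + y *\<^sub>R B + z *\<^sub>R C"
  define D where "D = (1 / (y + z)) *\<^sub>R (y *\<^sub>R B + z *\<^sub>R C)"
  have x: "x = 1 - y - z" using assms(2) by simp
  have "wedge (P - A) (C - B) = (y + z) * wedge (B - A) (C - A)"
    by (simp add: P_def x wedge_def algebra_simps)
  hence w: "wedge (P - A) (C - B) \<noteq> 0" using assms by simp
  hence "A \<noteq> P" "B \<noteq> C" by auto
  have "D - A = (1 / (y + z)) *\<^sub>R (P - A)"
    unfolding D_def weighted_mean_diff[OF refl assms(3)]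
    by (simp add: P_def x algebra_simps)
  moreover have "D - B = (z / (y + z)) *\<^sub>R (C - B)"
    unfolding D_def weighted_mean_diff[OF refl assms(3)] by simp
  ultimately show ?thesis
    unfolding side_trace_def P_def[symmetric] D_def[symmetric]
    using w by (simp add: line_eq \<open>A \<noteq> P\<close> \<open>B \<noteq> C\<close> meet_ordinary_lines)
qed

lemma trace_refl_eq:
  assumes "wedge (B - A) (C - A) \<noteq> 0" "x + y + z = 1" "y + z \<noteq> 0"
  shows "trace_refl A B C (Ordinary (x *\<^sub>R A + y *\<^sub>R B + z *\<^sub>R C))
    = Ordinary ((1 / (y + z)) *\<^sub>R (z *\<^sub>R B + y *\<^sub>R C))"
proof -
  have "point_reflection (midpoint B C) ((1 / (y + z)) *\<^sub>R (y *\<^sub>R B + z *\<^sub>R C))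
      = (1 / (y + z)) *\<^sub>R (z *\<^sub>R B + y *\<^sub>R C)"
    using weighted_mean_add_reversed[OF refl assms(3), of B C]
    by (simp add: point_reflection_def midpoint_def algebra_simps)
  thus ?thesis by (simp add: trace_refl_def side_trace_eq[OF assms])
qed

lemma isotomic_cevian:
  assumes "wedge (B - A) (C - A) \<noteq> 0" "x + y + z = 1" "y + z \<noteq> 0"
  shows "join (Ordinary A) (trace_refl A B C (Ordinary (x *\<^sub>R A + y *\<^sub>R B + z *\<^sub>R C)))
      = ordinary_line A (z *\<^sub>R (B - A) + y *\<^sub>R (C - A))"
    and "z *\<^sub>R (B - A) + y *\<^sub>R (C - A) \<noteq> 0"
proof -
  let ?u = "z *\<^sub>R (B - A) + y *\<^sub>R (C - A)"
  define D where "D = (1 / (y + z)) *\<^sub>R (z *\<^sub>R B + y *\<^sub>R C)"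
  have "wedge ?u (C - B) = (y + z) * wedge (B - A) (C - A)"
    by (simp add: wedge_def algebra_simps)
  thus u: "?u \<noteq> 0" using assms by auto
  have D: "D - A = (1 / (y + z)) *\<^sub>R ?u"
    unfolding D_def by (rule weighted_mean_diff) (use assms(3) in simp_all)
  hence "A \<noteq> D" using u assms(3) by auto
  hence "line A D = ordinary_line A (D - A)" by (rule line_eq)
  also have "\<dots> = ordinary_line A ?u"
    by (rule ordinary_line_eqI) (use \<open>A \<noteq> D\<close> u D in auto)
  finally show "join (Ordinary A) (trace_refl A B C (Ordinary (x *\<^sub>R A + y *\<^sub>R B + z *\<^sub>R C)))
      = ordinary_line A ?u"
    by (simp only: trace_refl_eq[OF assms] D_def)
qed


text \<open>
  The lines \<open>AD\<^sub>3\<close> and \<open>BE\<^sub>3\<close> are distinct because \<open>B\<close> is not on the former, so a point on both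
  is determined, whether it is ordinary or infinite.
\<close>
lemma isotomic_conjugate_eqI:
  assumes "wedge (B - A) (C - A) \<noteq> 0" "x + y + z = 1"
    and "y \<noteq> 0" "y + z \<noteq> 0" "z + x \<noteq> 0" "x + y \<noteq> 0"
    and "X \<in> ordinary_line A (z *\<^sub>R (B - A) + y *\<^sub>R (C - A))"
    and "X \<in> ordinary_line B (x *\<^sub>R (C - B) + z *\<^sub>R (A - B))"
    and "X \<in> ordinary_line C (y *\<^sub>R (A - C) + x *\<^sub>R (B - C))"
  shows "isotomic_conjugate A B C (Ordinary (x *\<^sub>R A + y *\<^sub>R B + z *\<^sub>R C)) = X"
proof -
  let ?P = "x *\<^sub>R A + y *\<^sub>R B + z *\<^sub>R C"
  let ?a = "ordinary_line A (z *\<^sub>R (B - A) + y *\<^sub>R (C - A))"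
  let ?b = "ordinary_line B (x *\<^sub>R (C - B) + z *\<^sub>R (A - B))"
  let ?c = "ordinary_line C (y *\<^sub>R (A - C) + x *\<^sub>R (B - C))"
  have w: "wedge (C - B) (A - B) \<noteq> 0" "wedge (A - C) (B - C) \<noteq> 0"
    using assms(1) by (simp_all add: wedge_def algebra_simps)
  have P: "?P = y *\<^sub>R B + z *\<^sub>R C + x *\<^sub>R A" "?P = z *\<^sub>R C + x *\<^sub>R A + y *\<^sub>R B"
    by (simp_all add: add_ac)
  have s: "y + z + x = 1" "z + x + y = 1" using assms(2) by simp_all
  note a = isotomic_cevian[OF assms(1,2,4)]
  note b = isotomic_cevian[OF w(1) s(1) assms(5), folded P(1)]
  note c = isotomic_cevian[OF w(2) s(2) assms(6), folded P(2)]
  have "wedge (z *\<^sub>R (B - A) + y *\<^sub>R (C - A)) (B - A) = - y * wedge (B - A) (C - A)"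
    by (simp add: wedge_def algebra_simps)
  hence "Ordinary B \<notin> ?a" "Ordinary B \<in> ?b" using assms(1,3) by simp_all
  hence "?a \<noteq> ?b" by metis
  show ?thesis
    unfolding isotomic_conjugate_def a(1) b(1) c(1)
  proof (rule the_equality)
    fix Y assume "Y \<in> ?a \<and> Y \<in> ?b \<and> Y \<in> ?c"
    thus "Y = X"
      using eline_unique[of ?a ?b Y X] \<open>?a \<noteq> ?b\<close> assms(7,8)
        ordinary_line_in_elines[OF a(2)] ordinary_line_in_elines[OF b(2)] by blast
  qed (use assms(7-9) in simp)
qed

lemma isotomic_conjugate_eq:
  assumes "wedge (B - A) (C - A) \<noteq> 0" "x + y + z = 1"
    and "y \<noteq> 0" "y + z \<noteq> 0" "z + x \<noteq> 0" "x + y \<noteq> 0"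
    and "y * z + z * x + x * y \<noteq> 0"
  shows "isotomic_conjugate A B C (Ordinary (x *\<^sub>R A + y *\<^sub>R B + z *\<^sub>R C))
    = Ordinary ((1 / (y * z + z * x + x * y)) *\<^sub>R ((y * z) *\<^sub>R A + (z * x) *\<^sub>R B + (x * y) *\<^sub>R C))"
proof -
  define s where "s = y * z + z * x + x * y"
  define X where "X = (1 / s) *\<^sub>R ((y * z) *\<^sub>R A + (z * x) *\<^sub>R B + (x * y) *\<^sub>R C)"
  have "s \<noteq> 0" using assms(7) by (simp add: s_def)
  have s: "y * z = s - z * x - x * y" by (simp add: s_def)
  have "X - A = (x / s) *\<^sub>R (z *\<^sub>R (B - A) + y *\<^sub>R (C - A))"
    using \<open>s \<noteq> 0\<close> by (simp add: X_def s plane_eq_iff field_simps)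
  moreover have "X - B = (y / s) *\<^sub>R (x *\<^sub>R (C - B) + z *\<^sub>R (A - B))"
    using \<open>s \<noteq> 0\<close> unfolding X_def plane_eq_iff by (simp add: field_simps) (simp add: s_def algebra_simps)
  moreover have "X - C = (z / s) *\<^sub>R (y *\<^sub>R (A - C) + x *\<^sub>R (B - C))"
    using \<open>s \<noteq> 0\<close> unfolding X_def plane_eq_iff by (simp add: field_simps) (simp add: s_def algebra_simps)
  ultimately show ?thesis
    unfolding s_def[symmetric] X_def[symmetric]
    by (intro isotomic_conjugate_eqI assms) simp_all
qed

text \<open>
  If \<open>yz + zx + xy = 0\<close>, the lines \<open>AD\<^sub>3\<close>, \<open>BE\<^sub>3\<close>, \<open>CF\<^sub>3\<close> are parallel: their direction
  vectors from \<open>isotomic_conjugate_eqI\<close>, multiplied by \<open>x\<close>, \<open>y\<close>, \<open>z\<close> respectively, coincide. Hence an ordinary isotomic conjugate forces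
  \<open>yz + zx + xy \<noteq> 0\<close>.
\<close>
lemma isotomic_conjugate_infinite:
  assumes "wedge (B - A) (C - A) \<noteq> 0" "x + y + z = 1"
    and "x \<noteq> 0" "y \<noteq> 0" "z \<noteq> 0" "y + z \<noteq> 0" "z + x \<noteq> 0" "x + y \<noteq> 0" "y * z + z * x + x * y = 0"
  shows "isotomic_conjugate A B C (Ordinary (x *\<^sub>R A + y *\<^sub>R B + z *\<^sub>R C)) \<in> line_at_infinity"
proof -
  let ?a = "z *\<^sub>R (B - A) + y *\<^sub>R (C - A)"
  let ?b = "x *\<^sub>R (C - B) + z *\<^sub>R (A - B)"
  let ?c = "y *\<^sub>R (A - C) + x *\<^sub>R (B - C)"
  have yz: "y * z = - z * x - x * y" using assms(9) by simp
  have ab: "y *\<^sub>R ?b = x *\<^sub>R ?a" and ac: "z *\<^sub>R ?c = x *\<^sub>R ?a"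
    by (simp_all add: plane_eq_iff algebra_simps) (use yz in algebra)+
  have "?a \<noteq> 0" using isotomic_cevian(2)[OF assms(1,2,6)] .
  hence "y *\<^sub>R ?b \<noteq> 0" "z *\<^sub>R ?c \<noteq> 0" unfolding ab ac using assms(3) by simp_all
  hence nz: "?b \<noteq> 0" "?c \<noteq> 0" by auto
  have "wedge (y *\<^sub>R ?b) ?a = 0" "wedge (z *\<^sub>R ?c) ?a = 0" unfolding ab ac by simp_all
  hence "wedge ?b ?a = 0" "wedge ?c ?a = 0" using assms(4,5) by simp_all
  hence "isotomic_conjugate A B C (Ordinary (x *\<^sub>R A + y *\<^sub>R B + z *\<^sub>R C)) = point_at_infinity ?a"
    using \<open>?a \<noteq> 0\<close> nz by (intro isotomic_conjugate_eqI assms) simp_all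
  thus ?thesis by simp
qed

section \<open>The affine involution exchanging two vectors\<close>

text \<open>
  The centre and the axis of \<open>\<eta>\<close> in terms of \<open>p\<close> and \<open>q = p'\<close>. Going from \<open>P\<close> by twice the vector
  \<open>Q - P = - p - q/2\<close> leads to \<open>G - (p + q)\<close>, and this is symmetric in \<open>p\<close> and \<open>q\<close>.
\<close>
lemma axis_and_center:
  fixes G p q :: plane
  assumes "wedge p q \<noteq> 0"
  defines "P \<equiv> G + p" and "P' \<equiv> G + q" and "Q \<equiv> G - (1/2) *\<^sub>R q" and "Q' \<equiv> G - (1/2) *\<^sub>R p"
  shows "meet (line P P') (line Q Q') = point_at_infinity (q - p)"
    and "meet (line P Q) (line P' Q') = Ordinary (G - (p + q))"
proof -
  have w: "wedge q p = - wedge p q" by (rule wedge_commute)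
  have "p \<noteq> q" using assms(1) by auto
  have d: "P' - P = q - p" "Q' - Q = (1/2) *\<^sub>R (q - p)" "Q - P = - p - (1/2) *\<^sub>R q" "Q' - P' = - q - (1/2) *\<^sub>R p"
    "(G - (p + q)) - P = 2 *\<^sub>R (Q - P)" "(G - (p + q)) - P' = 2 *\<^sub>R (Q' - P')"
    by (simp_all add: P_def P'_def Q_def Q'_def plane_eq_iff)
  have PQ: "wedge (Q - P) (Q' - P') \<noteq> 0" unfolding d using assms(1) by (simp add: wedge_distribs w)
  hence ne: "P \<noteq> Q" "P' \<noteq> Q'" by auto
  have ne': "P \<noteq> P'" "Q \<noteq> Q'" using d(1,2) \<open>p \<noteq> q\<close> by auto
  have "wedge (q - p) (Q - P) \<noteq> 0" unfolding d using assms(1) by (simp add: wedge_distribs w)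
  thus "meet (line P P') (line Q Q') = point_at_infinity (q - p)"
    using \<open>p \<noteq> q\<close> unfolding line_eq[OF ne'(1)] line_eq[OF ne'(2)] d(1,2)
    by (intro meet_parallel_lines) simp_all
  show "meet (line P Q) (line P' Q') = Ordinary (G - (p + q))"
    unfolding line_eq[OF ne(1)] line_eq[OF ne(2)]
    using PQ by (intro meet_ordinary_lines) (simp_all add: d(5,6))
qed

text \<open>
  The reflection that fixes the line through \<open>G\<close> with direction \<open>p + q\<close> and reverses \<open>q - p\<close>; for independent
  \<open>p\<close> and \<open>q\<close> it is the affine map fixing \<open>G\<close> and exchanging \<open>p\<close> and \<open>q\<close>. The explicit formula is visibly affine
  in \<open>X\<close>.
\<close>
definition swap_map :: "plane \<Rightarrow> plane \<Rightarrow> plane \<Rightarrow> plane \<Rightarrow> plane" where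
  "swap_map G p q X = X - (wedge (p + q) (X - G) / wedge p q) *\<^sub>R (q - p)"

lemma affine_reflection_eq_swap_map:
  assumes "wedge p q \<noteq> 0"
  shows "affine_reflection (point_at_infinity (q - p)) (ordinary_line G (p + q)) Y = swap_map G p q Y"
proof -
  have "wedge (p + q) (q - p) = 2 * wedge p q" by (simp add: wedge_def algebra_simps)
  thus ?thesis using assms by (simp add: affine_reflection_eq swap_map_def)
qed

lemma swap_map_coordinates:
  assumes "wedge p q \<noteq> 0"
  shows "swap_map G p q (G + a *\<^sub>R p + b *\<^sub>R q) = G + b *\<^sub>R p + a *\<^sub>R q"
proof -
  have "wedge (p + q) (G + a *\<^sub>R p + b *\<^sub>R q - G) = (b - a) * wedge p q"
    by (simp add: wedge_distribs wedge_commute[of q p] algebra_simps)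
  hence "wedge (p + q) (G + a *\<^sub>R p + b *\<^sub>R q - G) / wedge p q = b - a" using assms by simp
  hence "swap_map G p q (G + a *\<^sub>R p + b *\<^sub>R q) = G + a *\<^sub>R p + b *\<^sub>R q - (b - a) *\<^sub>R (q - p)"
    by (simp only: swap_map_def)
  thus ?thesis by (simp add: algebra_simps)
qed

lemma affine_map_swap_map: "affine_map (swap_map G p q)"
proof -
  define L where "L X = X - wedge (p + q) X *\<^sub>R ((1 / wedge p q) *\<^sub>R (q - p))" for X
  have "linear L" unfolding L_def by (intro linear_compose_sub linear_wedge linear_ident)
  moreover have "swap_map G p q X = L X + (wedge (p + q) G / wedge p q) *\<^sub>R (q - p)" for X
    by (simp add: swap_map_def L_def wedge_distribs(4) diff_divide_distrib scaleR_diff_left)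
  ultimately show ?thesis unfolding affine_map_def by blast
qed

lemma swap_map_involution:
  assumes "wedge p q \<noteq> 0"
  shows "swap_map G p q \<circ> swap_map G p q = id"
proof (rule affine_map_eqI)
  have "swap_map G p q G = G" "swap_map G p q (G + p) = G + q" "swap_map G p q (G + q) = G + p"
    using swap_map_coordinates[OF assms, of G 0 0] swap_map_coordinates[OF assms, of G 1 0]
      swap_map_coordinates[OF assms, of G 0 1] by simp_all
  thus "(swap_map G p q \<circ> swap_map G p q) G = id G"
    "(swap_map G p q \<circ> swap_map G p q) (G + p) = id (G + p)"
    "(swap_map G p q \<circ> swap_map G p q) (G + q) = id (G + q)" by simp_all
qed (use assms in \<open>simp_all add: affine_map_compose affine_map_swap_map affine_map_id\<close>)


section \<open>The configuration in barycentric coordinates\<close>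

lemma barycentric_side:
  assumes "wedge (B - A) (C - A) \<noteq> 0" "x + y + z = 1"
  shows "Ordinary (x *\<^sub>R A + y *\<^sub>R B + z *\<^sub>R C) \<in> line B C \<longleftrightarrow> x = 0"
proof -
  have "B \<noteq> C" using assms(1) by auto
  have x: "x = 1 - y - z" using assms(2) by simp
  have "wedge (C - B) (x *\<^sub>R A + y *\<^sub>R B + z *\<^sub>R C - B) = x * wedge (B - A) (C - A)"
    unfolding x by (simp add: wedge_def algebra_simps)
  thus ?thesis using assms(1) by (simp add: line_eq \<open>B \<noteq> C\<close>)
qed

text \<open>
  On the median, \<open>P - A\<close> equals \<open>3 y (G - A)\<close>.
\<close>
lemma barycentric_median:
  assumes "wedge (B - A) (C - A) \<noteq> 0" "x + y + z = 1" "y = z"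
  shows "Ordinary (x *\<^sub>R A + y *\<^sub>R B + z *\<^sub>R C) \<in> line A ((1/3) *\<^sub>R (A + B + C))"
proof -
  let ?G = "(1/3) *\<^sub>R (A + B + C)"
  have "wedge (?G - A) (C - B) = 2/3 * wedge (B - A) (C - A)"
    by (simp add: wedge_def field_simps)
  hence "A \<noteq> ?G" using assms(1) by auto
  moreover have "x *\<^sub>R A + y *\<^sub>R B + z *\<^sub>R C - A = (3 * y) *\<^sub>R (?G - A)"
    using assms(2) unfolding assms(3) by (simp add: plane_eq_iff) algebra
  ultimately show ?thesis by (simp add: line_eq)
qed

lemma K_map_eq: "K_map A B C X = (1/2) *\<^sub>R (A + B + C - X)"
  by (simp add: K_map_def homothety_def centroid_def plane_eq_iff field_simps)

lemma inv_K_map: "inv_into UNIV (K_map A B C) X = A + B + C - 2 *\<^sub>R X"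
  by (rule inv_f_eq) (auto simp: K_map_eq inj_def)

text \<open>
  The inverse of \<open>K\<close> takes \<open>B\<close> and \<open>C\<close> to \<open>A + C - B\<close> and \<open>A + B - C\<close>, so the line through these points is the
  parallel to \<open>BC\<close> through \<open>A\<close>.
\<close>
lemma barycentric_anticomplementary_side:
  assumes "wedge (B - A) (C - A) \<noteq> 0" "x + y + z = 1" "y + z = 0"
  shows "Ordinary (x *\<^sub>R A + y *\<^sub>R B + z *\<^sub>R C)
    \<in> line (inv_into UNIV (K_map A B C) B) (inv_into UNIV (K_map A B C) C)"
proof -
  have x: "x = 1" "y = - z" using assms(2,3) by simp_all
  have "B \<noteq> C" using assms(1) by auto
  hence "A + B + C - 2 *\<^sub>R B \<noteq> A + B + C - 2 *\<^sub>R C" by simp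
  thus ?thesis
    unfolding inv_K_map x by (simp add: line_eq wedge_def algebra_simps)
qed

text \<open>
  The geometric position of \<open>P\<close> expressed by its barycentric coordinates; in the final proof each
  nonvanishing condition is read off from the corresponding geometric hypothesis.
\<close>
locale barycentric_point =
  fixes A B C :: plane and x y z :: real
  assumes nondegenerate: "wedge (B - A) (C - A) \<noteq> 0"
    and sum_1: "x + y + z = 1"
    and off_sides: "x \<noteq> 0" "y \<noteq> 0" "z \<noteq> 0"
    and off_anticomplementary_sides: "y + z \<noteq> 0" "z + x \<noteq> 0" "x + y \<noteq> 0"
    and off_medians: "y \<noteq> z" "z \<noteq> x" "x \<noteq> y"
    and ordinary_conjugate: "y * z + z * x + x * y \<noteq> 0"
begin

definition "s = y * z + z * x + x * y"
definition "P = x *\<^sub>R A + y *\<^sub>R B + z *\<^sub>R C"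
definition "P' = (1 / s) *\<^sub>R ((y * z) *\<^sub>R A + (z * x) *\<^sub>R B + (x * y) *\<^sub>R C)"
definition "G = centroid A B C"
definition "K = K_map A B C"
definition "D = (1 / (y + z)) *\<^sub>R (y *\<^sub>R B + z *\<^sub>R C)"
definition "E = (1 / (z + x)) *\<^sub>R (z *\<^sub>R C + x *\<^sub>R A)"
definition "F = (1 / (x + y)) *\<^sub>R (x *\<^sub>R A + y *\<^sub>R B)"
definition "D\<^sub>3 = (1 / (y + z)) *\<^sub>R (z *\<^sub>R B + y *\<^sub>R C)"
definition "E\<^sub>3 = (1 / (z + x)) *\<^sub>R (x *\<^sub>R C + z *\<^sub>R A)"
definition "F\<^sub>3 = (1 / (x + y)) *\<^sub>R (y *\<^sub>R A + x *\<^sub>R B)"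
definition "T = T_map A B C (Ordinary P)"
definition "T' = T_map' A B C (Ordinary P)"
definition "\<eta> = eta A B C (Ordinary P)"

lemma s_nonzero: "s \<noteq> 0"
  using ordinary_conjugate by (simp add: s_def)

lemma rotated:
  "wedge (C - B) (A - B) \<noteq> 0" "wedge (A - C) (B - C) \<noteq> 0"
  "y + z + x = 1" "z + x + y = 1"
  "P = y *\<^sub>R B + z *\<^sub>R C + x *\<^sub>R A" "P = z *\<^sub>R C + x *\<^sub>R A + y *\<^sub>R B"
  using nondegenerate sum_1 by (simp_all add: wedge_def algebra_simps P_def)

lemma T_vertices: "affine_map T" "T A = D" "T B = E" "T C = F"
  using affine_map_taking[OF nondegenerate, of D E F]
  unfolding T_def T_map_def D_def E_def F_def
    side_trace_eq[OF nondegenerate sum_1 off_anticomplementary_sides(1), folded P_def]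
    side_trace_eq[OF rotated(1,3) off_anticomplementary_sides(2), folded rotated(5)]
    side_trace_eq[OF rotated(2,4) off_anticomplementary_sides(3), folded rotated(6)]
  by blast+

lemma T'_vertices: "affine_map T'" "T' A = D\<^sub>3" "T' B = E\<^sub>3" "T' C = F\<^sub>3"
  using affine_map_taking[OF nondegenerate, of D\<^sub>3 E\<^sub>3 F\<^sub>3]
  unfolding T'_def T_map'_def D\<^sub>3_def E\<^sub>3_def F\<^sub>3_def
    trace_refl_eq[OF nondegenerate sum_1 off_anticomplementary_sides(1), folded P_def]
    trace_refl_eq[OF rotated(1,3) off_anticomplementary_sides(2), folded rotated(5)]
    trace_refl_eq[OF rotated(2,4) off_anticomplementary_sides(3), folded rotated(6)]
  by blast+

text \<open>
  The area of the cevian triangle \<open>DEF\<close> is \<open>2xyz / ((y+z)(z+x)(x+y))\<close> times that of \<open>ABC\<close>, so it does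
  not degenerate when \<open>P\<close> is off the sides.
\<close>
lemma bij_T: "bij T"
proof (rule affine_map_bij[OF T_vertices(1) nondegenerate])
  define r where "r = (y + z) * (z + x) * (x + y)"
  have "r \<noteq> 0" using off_anticomplementary_sides by (simp add: r_def)
  let ?b = "B - A" let ?c = "C - A"
  have "D - A = (y / (y + z)) *\<^sub>R ?b + (z / (y + z)) *\<^sub>R ?c"
    "E - A = (z / (z + x)) *\<^sub>R ?c" "F - A = (y / (x + y)) *\<^sub>R ?b"
    using weighted_mean_diff[OF refl off_anticomplementary_sides(1), of B C A]
      weighted_mean_diff[OF refl off_anticomplementary_sides(2), of C A A]
      weighted_mean_diff[OF refl off_anticomplementary_sides(3), of A B A]
    by (simp_all add: D_def E_def F_def scaleR_add_right)
  moreover have "E - D = (E - A) - (D - A)" "F - D = (F - A) - (D - A)" by simp_all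
  ultimately have ED: "E - D = (- (y / (y + z))) *\<^sub>R ?b + (z / (z + x) - z / (y + z)) *\<^sub>R ?c"
    and FD: "F - D = (y / (x + y) - y / (y + z)) *\<^sub>R ?b + (- (z / (y + z))) *\<^sub>R ?c"
    by (simp_all only: scaleR_diff_left scaleR_minus_left) simp_all
  have "wedge (E - D) (F - D) = (- (y / (y + z)) * - (z / (y + z))
      - (z / (z + x) - z / (y + z)) * (y / (x + y) - y / (y + z))) * wedge ?b ?c"
    unfolding ED FD by (rule wedge_combinations)
  also have "- (y / (y + z)) * - (z / (y + z)) - (z / (z + x) - z / (y + z)) * (y / (x + y) - y / (y + z))
      = 2 * x * y * z / r"
    using off_anticomplementary_sides unfolding r_def by (simp add: divide_simps) algebra
  finally show "wedge (T B - T A) (T C - T A) \<noteq> 0"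
    using \<open>r \<noteq> 0\<close> off_sides nondegenerate by (simp add: T_vertices)
qed

lemma isotomic_conjugate_P: "isotomic_conjugate A B C (Ordinary P) = Ordinary P'"
  unfolding P_def P'_def s_def
  by (intro isotomic_conjugate_eq nondegenerate sum_1 off_sides off_anticomplementary_sides ordinary_conjugate)

lemma affine_map_K: "affine_map K"
proof -
  have "linear (\<lambda>X. - (1/2) *\<^sub>R X :: plane)" by (intro linearI) (simp_all add: algebra_simps)
  moreover have "K = (\<lambda>X. - (1/2) *\<^sub>R X + (1/2) *\<^sub>R (A + B + C))"
    by (simp add: K_def K_map_eq fun_eq_iff plane_eq_iff field_simps)
  ultimately show ?thesis unfolding affine_map_def by blast
qed

text \<open>
  Reflected traces have the midpoints of the sides as centres of symmetry, so the identity holds at the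
  vertices; it extends to all points because \<open>T\<close>, \<open>T'\<close> and \<open>K\<close> preserve barycentric combinations.
\<close>
lemma T_plus_T': "T X + T' X = 2 *\<^sub>R K X"
proof -
  obtain a b c where abc: "a + b + c = 1" "X = a *\<^sub>R A + b *\<^sub>R B + c *\<^sub>R C"
    using barycentric_coordinates nondegenerate by metis
  have "D + D\<^sub>3 = 2 *\<^sub>R K A" "E + E\<^sub>3 = 2 *\<^sub>R K B" "F + F\<^sub>3 = 2 *\<^sub>R K C"
    using weighted_mean_add_reversed[OF refl off_anticomplementary_sides(1), of B C]
      weighted_mean_add_reversed[OF refl off_anticomplementary_sides(2), of C A]
      weighted_mean_add_reversed[OF refl off_anticomplementary_sides(3), of A B]
    unfolding K_def K_map_eq D_def E_def F_def D\<^sub>3_def E\<^sub>3_def F\<^sub>3_def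
    by (simp_all add: add_ac)
  moreover have "T X + T' X = a *\<^sub>R (D + D\<^sub>3) + b *\<^sub>R (E + E\<^sub>3) + c *\<^sub>R (F + F\<^sub>3)"
    unfolding abc(2)
    by (simp add: affine_map_combination[OF _ abc(1)] T_vertices T'_vertices scaleR_add_right)
  ultimately show ?thesis
    unfolding abc(2)
    by (simp add: affine_map_combination[OF affine_map_K abc(1)] scaleR_add_right mult_ac)
qed

text \<open>
  The point \<open>Q = K(P')\<close> has coordinates proportional to \<open>x(y+z)\<close>, \<open>y(z+x)\<close>, \<open>z(x+y)\<close>. These factors cancel
  the denominators of \<open>D\<close>, \<open>E\<close>, \<open>F\<close>, and the image is \<open>x(yB + zC) + y(zC + xA) + z(xA + yB)\<close> up to
  normalisation, which is \<open>Q\<close> again.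
\<close>
lemma T_fixes_complement_of_P': "T (K P') = K P'"
proof -
  have KP': "K P' = (x * (y + z) / (2 * s)) *\<^sub>R A + (y * (z + x) / (2 * s)) *\<^sub>R B + (z * (x + y) / (2 * s)) *\<^sub>R C"
    using s_nonzero unfolding K_def K_map_eq P'_def plane_eq_iff
    by (simp add: field_simps) (simp add: s_def algebra_simps)
  have sum: "x * (y + z) / (2 * s) + y * (z + x) / (2 * s) + z * (x + y) / (2 * s) = 1"
    using s_nonzero by (simp add: field_simps) (simp add: s_def algebra_simps)
  have "(x * (y + z) / (2 * s)) *\<^sub>R D = (x / (2 * s)) *\<^sub>R (y *\<^sub>R B + z *\<^sub>R C)"
    "(y * (z + x) / (2 * s)) *\<^sub>R E = (y / (2 * s)) *\<^sub>R (z *\<^sub>R C + x *\<^sub>R A)"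
    "(z * (x + y) / (2 * s)) *\<^sub>R F = (z / (2 * s)) *\<^sub>R (x *\<^sub>R A + y *\<^sub>R B)"
    using off_anticomplementary_sides by (simp_all add: D_def E_def F_def)
  thus ?thesis
    unfolding KP' affine_map_combination[OF T_vertices(1) sum] T_vertices
    using s_nonzero by (simp add: plane_eq_iff field_simps)
qed

text \<open>
  The same cancellation at \<open>Q' = K(P)\<close>, whose coordinates are half of \<open>y + z\<close>, \<open>z + x\<close>, \<open>x + y\<close>.
\<close>
lemma T_complement_of_P: "T (K P) = P"
proof -
  have KP: "K P = ((y + z) / 2) *\<^sub>R A + ((z + x) / 2) *\<^sub>R B + ((x + y) / 2) *\<^sub>R C"
    using sum_1 unfolding K_def K_map_eq P_def plane_eq_iff by simp algebra
  have sum: "(y + z) / 2 + (z + x) / 2 + (x + y) / 2 = 1"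
    using sum_1 by argo
  have "((y + z) / 2) *\<^sub>R D = (1/2) *\<^sub>R (y *\<^sub>R B + z *\<^sub>R C)"
    "((z + x) / 2) *\<^sub>R E = (1/2) *\<^sub>R (z *\<^sub>R C + x *\<^sub>R A)"
    "((x + y) / 2) *\<^sub>R F = (1/2) *\<^sub>R (x *\<^sub>R A + y *\<^sub>R B)"
    using off_anticomplementary_sides by (simp_all add: D_def E_def F_def)
  thus ?thesis
    unfolding KP affine_map_combination[OF T_vertices(1) sum] T_vertices
    by (simp add: P_def plane_eq_iff field_simps)
qed

text \<open>
  The coordinates of both \<open>T(G) - G\<close> and \<open>P' - P\<close> carry the factors \<open>x\<^sup>2 - yz\<close>, \<open>y\<^sup>2 - zx\<close>, \<open>z\<^sup>2 - xy\<close>: the first are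
  \<open>(x\<^sup>2 - yz) / (3(z+x)(x+y))\<close> and its cyclic images, the second \<open>- (y+z)(x\<^sup>2 - yz) / s\<close> and its cyclic
  images. Their quotient is therefore the same for all three coordinates.
\<close>
lemma T_moves_G_along_PP': "\<exists>k. T G = G + k *\<^sub>R (P' - P)"
proof -
  define r where "r = (y + z) * (z + x) * (x + y)"
  have r: "r \<noteq> 0" using off_anticomplementary_sides by (simp add: r_def)
  have G: "G = (1/3) *\<^sub>R A + (1/3) *\<^sub>R B + (1/3) *\<^sub>R C"
    by (simp add: G_def centroid_def scaleR_add_right)
  \<comment> \<open>The homogeneous form of \<open>v w / s - u\<close> needs the factor \<open>u + v + w = 1\<close> inserted before \<open>v + w\<close> splits off.\<close>
  have coeff: "(u / (w + u) + u / (u + v)) / 3 - 1/3 = - (s / (3 * r)) * (v * w / s - u)"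
    if "u + v + w = 1" "v + w \<noteq> 0" "w + u \<noteq> 0" "u + v \<noteq> 0"
      "s = v * w + w * u + u * v" "r = (v + w) * (w + u) * (u + v)" for u v w
  proof -
    have "(u / (w + u) + u / (u + v)) / 3 - 1/3 = (u\<^sup>2 - v * w) / (3 * (w + u) * (u + v))"
      using that(3,4) by (simp add: divide_simps) algebra
    also have "\<dots> = (v + w) * (u\<^sup>2 - v * w) / (3 * r)"
      using that(2) by (simp add: that(6))
    also have "(v + w) * (u\<^sup>2 - v * w) = - (v * w - u * s)"
      using that(1) unfolding that(5) by algebra
    also have "- (v * w - u * s) / (3 * r) = - (s / (3 * r)) * (v * w / s - u)"
      using s_nonzero r by (simp add: field_simps)
    finally show ?thesis .
  qed
  have cA: "(x / (z + x) + x / (x + y)) / 3 - 1/3 = - (s / (3 * r)) * (y * z / s - x)"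
    by (rule coeff) (use sum_1 off_anticomplementary_sides in \<open>simp_all add: s_def r_def\<close>)
  have cB: "(y / (x + y) + y / (y + z)) / 3 - 1/3 = - (s / (3 * r)) * (z * x / s - y)"
    by (rule coeff) (use sum_1 off_anticomplementary_sides in \<open>simp_all add: s_def r_def\<close>)
  have cC: "(z / (y + z) + z / (z + x)) / 3 - 1/3 = - (s / (3 * r)) * (x * y / s - z)"
    by (rule coeff) (use sum_1 off_anticomplementary_sides in \<open>simp_all add: s_def r_def\<close>)
  have "T G = (1/3) *\<^sub>R D + (1/3) *\<^sub>R E + (1/3) *\<^sub>R F"
    unfolding G by (simp add: affine_map_combination[OF T_vertices(1)] T_vertices)
  hence "T G - G = (1/3) *\<^sub>R D + (1/3) *\<^sub>R E + (1/3) *\<^sub>R F - G" by simp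
  also have "\<dots> = ((x / (z + x) + x / (x + y)) / 3 - 1/3) *\<^sub>R A
      + ((y / (x + y) + y / (y + z)) / 3 - 1/3) *\<^sub>R B + ((z / (y + z) + z / (z + x)) / 3 - 1/3) *\<^sub>R C"
  proof -
    have "(1/3) *\<^sub>R a *\<^sub>R (y *\<^sub>R B + z *\<^sub>R C) + (1/3) *\<^sub>R b *\<^sub>R (z *\<^sub>R C + x *\<^sub>R A)
        + (1/3) *\<^sub>R c *\<^sub>R (x *\<^sub>R A + y *\<^sub>R B) - G
      = ((x * b + x * c) / 3 - 1/3) *\<^sub>R A + ((y * c + y * a) / 3 - 1/3) *\<^sub>R B
        + ((z * a + z * b) / 3 - 1/3) *\<^sub>R C" for a b c
      by (simp add: G plane_eq_iff field_simps)
    from this[of "1 / (y + z)" "1 / (z + x)" "1 / (x + y)"] show ?thesis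
      by (simp only: D_def E_def F_def times_divide_eq_right mult_1_right)
  qed
  also have "\<dots> = - (s / (3 * r)) *\<^sub>R (P' - P)"
  proof -
    have "P' - P = (y * z / s - x) *\<^sub>R A + (z * x / s - y) *\<^sub>R B + (x * y / s - z) *\<^sub>R C"
      by (simp add: P_def P'_def scaleR_add_right scaleR_diff_left)
    thus ?thesis unfolding cA cB cC by (simp only: scaleR_add_right scaleR_scaleR)
  qed
  finally have "T G = G + (- (s / (3 * r))) *\<^sub>R (P' - P)" by (simp add: algebra_simps)
  thus ?thesis by blast
qed

abbreviation "p \<equiv> P - G"
abbreviation "p' \<equiv> P' - G"

text \<open>
  Up to a nonzero factor, the determinant is the Vandermonde product \<open>(y-z)(z-x)(x-y)\<close>, whose factors vanish
  exactly on the three medians.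
\<close>
lemma p_p'_independent: "wedge p p' \<noteq> 0"
proof -
  let ?b = "B - A" let ?c = "C - A"
  have x: "x = 1 - y - z" using sum_1 by simp
  have yz: "y * z = s - z * x - x * y" by (simp add: s_def)
  have p: "p = (y - 1/3) *\<^sub>R ?b + (z - 1/3) *\<^sub>R ?c"
    unfolding P_def G_def centroid_def unfolding x by (simp add: plane_eq_iff field_simps)
  have p': "p' = (z * x / s - 1/3) *\<^sub>R ?b + (x * y / s - 1/3) *\<^sub>R ?c"
    using s_nonzero unfolding P'_def G_def centroid_def yz by (simp add: plane_eq_iff field_simps)
  have "wedge p p' = ((y - 1/3) * (x * y / s - 1/3) - (z - 1/3) * (z * x / s - 1/3)) * wedge ?b ?c"
    unfolding p p' by (rule wedge_combinations)
  also have "(y - 1/3) * (x * y / s - 1/3) - (z - 1/3) * (z * x / s - 1/3)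
      = (3 * x * (y\<^sup>2 - z\<^sup>2) - (y - z) * (x + s)) / (3 * s)"
    using s_nonzero by (simp add: field_simps power2_eq_square)
  also have "3 * x * (y\<^sup>2 - z\<^sup>2) - (y - z) * (x + s) = (y - z) * (z - x) * (x - y)"
    using sum_1 unfolding s_def by algebra
  finally show ?thesis using nondegenerate s_nonzero off_medians by simp
qed

lemma points_from_G:
  "G + p = P" "G + p' = P'" "G - (1/2) *\<^sub>R p' = K P'" "G - (1/2) *\<^sub>R p = K P"
  by (simp_all add: G_def centroid_def K_def K_map_eq plane_eq_iff field_simps)

lemma \<eta>_eq_swap_map: "\<eta> = swap_map G p p'"
proof
  fix Y
  note w = p_p'_independent
  have "p + p' \<noteq> 0"
  proof
    assume "p + p' = 0"
    hence "wedge p p' = wedge p (- p)" by (metis add_eq_0_iff)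
    thus False using w by (simp only: wedge_simps)
  qed
  have axis: "line G (G - m) = ordinary_line G m" if "m \<noteq> 0" for m
    using that by (simp add: line_eq ordinary_line_eqI)
  have "\<eta> Y = affine_reflection (point_at_infinity (p' - p)) (ordinary_line G (p + p')) Y"
    using axis_and_center[OF w, of G] axis[OF \<open>p + p' \<noteq> 0\<close>]
    by (simp add: \<eta>_def eta_def isotomic_conjugate_P points_from_G flip: G_def K_def)
  also have "\<dots> = swap_map G p p' Y" by (rule affine_reflection_eq_swap_map[OF w])
  finally show "\<eta> Y = swap_map G p p' Y" .
qed

lemma \<eta>_coordinates: "\<eta> (G + a *\<^sub>R p + b *\<^sub>R p') = G + b *\<^sub>R p + a *\<^sub>R p'"
  unfolding \<eta>_eq_swap_map by (rule swap_map_coordinates[OF p_p'_independent])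

text \<open>
  Two affine maps are compared at \<open>Q'\<close>, \<open>G\<close> and \<open>Q\<close>. At \<open>G\<close> the argument is that
  \<open>T\<^sub>P(G) - G\<close> is a multiple of \<open>p' - p\<close>, which \<open>\<eta>\<close> negates, while \<open>T\<^sub>P\<^sub>'(G) - G\<close> is its negative by \<open>T_plus_T'\<close>.
\<close>
lemma \<eta>_intertwines: "\<eta> \<circ> T = T' \<circ> \<eta>"
proof (rule affine_map_eqI[of _ _ "K P" G "K P'"])
  have \<eta>: "affine_map \<eta>" unfolding \<eta>_eq_swap_map by (rule affine_map_swap_map)
  show "affine_map (\<eta> \<circ> T)" "affine_map (T' \<circ> \<eta>)"
    by (intro affine_map_compose \<eta> T_vertices T'_vertices)+
  have "wedge (K P - G) (K P' - G) = wedge p p' / 4"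
    by (simp flip: points_from_G(3,4))
  thus "wedge (K P - G) (K P' - G) \<noteq> 0" using p_p'_independent by simp
  have \<eta>_G: "\<eta> G = G" and \<eta>_P: "\<eta> P = P'" and \<eta>_KP: "\<eta> (K P) = K P'" and \<eta>_KP': "\<eta> (K P') = K P"
    using \<eta>_coordinates[of 0 0] \<eta>_coordinates[of 1 0] \<eta>_coordinates[of "- (1/2)" 0]
      \<eta>_coordinates[of 0 "- (1/2)"]
    by (simp_all flip: points_from_G(3,4))
  have K: "2 *\<^sub>R K G = 2 *\<^sub>R G" "2 *\<^sub>R K (K P) = K P + P" "2 *\<^sub>R K (K P') = K P' + P'"
    by (simp_all add: G_def centroid_def K_def K_map_eq plane_eq_iff field_simps)
  obtain k where k: "T G = G + k *\<^sub>R (P' - P)" using T_moves_G_along_PP' by blast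
  have "T' G = 2 *\<^sub>R G - T G" using T_plus_T'[of G] by (simp add: K(1) algebra_simps)
  also have "\<dots> = G + k *\<^sub>R p + (- k) *\<^sub>R p'" by (simp add: k scaleR_2 algebra_simps)
  also have "\<dots> = \<eta> (G + (- k) *\<^sub>R p + k *\<^sub>R p')" by (rule \<eta>_coordinates[symmetric])
  also have "G + (- k) *\<^sub>R p + k *\<^sub>R p' = T G" by (simp add: k algebra_simps)
  finally show "(\<eta> \<circ> T) G = (T' \<circ> \<eta>) G" by (simp add: \<eta>_G)
  have "T' (K P') = P'" using T_plus_T'[of "K P'"] by (simp add: K(3) T_fixes_complement_of_P')
  thus "(\<eta> \<circ> T) (K P) = (T' \<circ> \<eta>) (K P)" by (simp add: T_complement_of_P \<eta>_P \<eta>_KP)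
  have "T' (K P) = K P" using T_plus_T'[of "K P"] by (simp add: K(2) T_complement_of_P)
  thus "(\<eta> \<circ> T) (K P') = (T' \<circ> \<eta>) (K P')" by (simp add: T_fixes_complement_of_P' \<eta>_KP')
qed

lemma T_T'_conjugate: "conjugate_in affine_group T T'"
  using conjugate_by_involution[OF T_vertices(1) bij_T _ _ \<eta>_intertwines]
    swap_map_involution[OF p_p'_independent] affine_map_swap_map
  by (simp add: \<eta>_eq_swap_map)

end

theorem theorem2p4:
  fixes A B C P :: plane
  assumes "\<not> collinear {A, B, C}"
    and "\<not> on_sides A B C (Ordinary P)"
    and "\<not> on_anticomplementary_sides A B C (Ordinary P)"
    and "\<not> on_medians A B C (Ordinary P)"
    and "isotomic_conjugate A B C (Ordinary P) \<notin> line_at_infinity"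
  shows "eta A B C (Ordinary P) \<circ> T_map A B C (Ordinary P)
           = T_map' A B C (Ordinary P) \<circ> eta A B C (Ordinary P)
         \<and> conjugate_in affine_group (T_map A B C (Ordinary P)) (T_map' A B C (Ordinary P))"
proof -
  have w: "wedge (B - A) (C - A) \<noteq> 0" using assms(1) by (simp add: collinear_iff_wedge)
  hence w': "wedge (C - B) (A - B) \<noteq> 0" "wedge (A - C) (B - C) \<noteq> 0"
    by (simp_all add: wedge_def algebra_simps)
  obtain x y z where sum: "x + y + z = 1" and P: "P = x *\<^sub>R A + y *\<^sub>R B + z *\<^sub>R C"
    using barycentric_coordinates w by metis
  \<comment> \<open>The conditions at \<open>B\<close> and \<open>C\<close> come from those at \<open>A\<close> by rotating the triangle; \<open>G\<close> and \<open>K\<close> are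
    invariant under the rotation.\<close>
  have sum': "y + z + x = 1" "z + x + y = 1" using sum by simp_all
  have P': "P = y *\<^sub>R B + z *\<^sub>R C + x *\<^sub>R A" "P = z *\<^sub>R C + x *\<^sub>R A + y *\<^sub>R B"
    by (simp_all add: P add_ac)
  have K: "K_map B C A = K_map A B C" "K_map C A B = K_map A B C"
    by (simp_all add: K_map_eq fun_eq_iff add_ac)
  have G: "(1/3) *\<^sub>R (B + C + A) = centroid A B C" "(1/3) *\<^sub>R (C + A + B) = centroid A B C"
    by (simp_all add: centroid_def add_ac)
  have xyz: "x \<noteq> 0" "y \<noteq> 0" "z \<noteq> 0"
    using assms(2) barycentric_side[OF w sum, folded P] barycentric_side[OF w'(1) sum'(1), folded P'(1)]
      barycentric_side[OF w'(2) sum'(2), folded P'(2)]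
    by (simp_all add: on_sides_def)
  have yz: "y + z \<noteq> 0" "z + x \<noteq> 0" "x + y \<noteq> 0"
    using assms(3) barycentric_anticomplementary_side[OF w sum, folded P]
      barycentric_anticomplementary_side[OF w'(1) sum'(1), folded P'(1), unfolded K]
      barycentric_anticomplementary_side[OF w'(2) sum'(2), folded P'(2), unfolded K]
    by (auto simp: on_anticomplementary_sides_def on_sides_def Let_def)
  have ne: "y \<noteq> z" "z \<noteq> x" "x \<noteq> y"
    using assms(4) barycentric_median[OF w sum, folded P centroid_def]
      barycentric_median[OF w'(1) sum'(1), folded P'(1), unfolded G]
      barycentric_median[OF w'(2) sum'(2), folded P'(2), unfolded G]
    by (auto simp: on_medians_def Let_def)
  have "y * z + z * x + x * y \<noteq> 0"
    using assms(5) isotomic_conjugate_infinite[OF w sum xyz yz, folded P] by blast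
  then interpret barycentric_point A B C x y z
    using w sum xyz yz ne by unfold_locales
  show ?thesis
    using \<eta>_intertwines T_T'_conjugate unfolding \<eta>_def T_def T'_def P_def P by blast
qed

end
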